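(* Let $n\geq 1$ and let $x>1$ be an odd integer. Then $$\sigma^\ast(x)=\sigma_n \text{ and } n(x)=n \quad\Longleftrightarrow\quad x \bmod 2^{\sigma_n}\in\mathcal{C}_n .$$ The map $\mathcal{A}_n\to\mathcal{C}_n$, $\boldsymbol{\alpha}\mapsto c(\boldsymbol{\alpha})$, is a bijection. Moreover, the map $c\mapsto q_{\sigma_n}(c)$ identifies $\mathcal{C}_n$ (bijectively) with the set of full admissible parity vectors $\{q(\boldsymbol{\alpha}):\boldsymbol{\alpha}\in\mathcal{A}_n\}$.
   Context: Let $T:\mathbb{Z}\to\mathbb{Z}$ be $T(x)=x/2$ for even $x$ and $T(x)=(3x+1)/2$ for odd $x$; $T^0(x)=x$, $T^s(x)=T(T^{s-1}(x))$. For a positive integer $x$ and $s\ge 0$ let $\varepsilon_s(x)=1$ if $T^s(x)$ is odd and $0$ otherwise. For $k\ge1$ let $q_k(x)=(\varepsilon_0(x),\ldots,\varepsilon_{k-1}(x))$ (parity vector of length $k$) and $m_k(x)=\sum_{s=0}^{k-1}\varepsilon_s(x)$. The coefficient stopping time is $\sigma^\ast(x)=\min\{k\ge1: 2^k>3^{m_k(x)}\}$ if this set is nonempty, and $\sigma^\ast(x)=\infty$ otherwise. If $x$ is odd and $\sigma^\ast(x)<\infty$, put $n(x)=m_{\sigma^\ast(x)}(x)-1$. For $n\ge1$ let $\kappa(n)=\lfloor n\log_2 3\rfloor$, and for $n\ge0$ let $\sigma_n=\lfloor 1+(n+1)\log_2 3\rfloor=\kappa(n+1)+1$. For $n\ge1$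 let $\mathcal{A}_n$ be the set of integer vectors $\boldsymbol{\alpha}=(\alpha_1,\ldots,\alpha_{n+1})$ with $0=\alpha_1<\alpha_2<\cdots<\alpha_{n+1}$ and $\alpha_{i+1}\le\kappa(i)$ for $1\le i\le n$. For $\boldsymbol{\alpha}\in\mathcal{A}_n$ let $q(\boldsymbol{\alpha})\in\{0,1\}^{\sigma_n}$ be the vector (indexed $0,\ldots,\sigma_n-1$) with ones precisely at positions $\alpha_1,\ldots,\alpha_{n+1}$, and let $c(\boldsymbol{\alpha})$ be the unique element of $\{1,\ldots,2^{\sigma_n}-1\}$ whose parity vector of length $\sigma_n$ is $q(\boldsymbol{\alpha})$ (the parity vector of length $L$ depends only on the class mod $2^L$ and gives a bijection $\mathbb{Z}/2^L\mathbb{Z}\to\{0,1\}^L$). Put $\mathcal{C}_n=\{c(\boldsymbol{\alpha}):\boldsymbol{\alpha}\in\mathcal{A}_n\}$. Here $x\bmod 2^{\sigma_n}$ is the residue of $x$ in $\{0,\ldots,2^{\sigma_n}-1\}$. *)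

theory Defs
  imports "HOL-Analysis.Analysis" "HOL-Library.Extended_Nat" "HOL-Library.FuncSet"
begin

definition T :: "int \<Rightarrow> int" where
  "T x = (if even x then x div 2 else (3 * x + 1) div 2)"

definition parity_bit :: "nat \<Rightarrow> int \<Rightarrow> nat" where
  "parity_bit s x = (if odd ((T ^^ s) x) then 1 else 0)"

text \<open>A vector in \<open>{0,1}\<^sup>k\<close> is a list of length \<open>k\<close>, indexed from 0.\<close>

definition parity_vector :: "nat \<Rightarrow> int \<Rightarrow> nat list" where
  "parity_vector k x = map (\<lambda>s. parity_bit s x) [0..<k]"

definition odd_count :: "nat \<Rightarrow> int \<Rightarrow> nat" where
  "odd_count k x = (\<Sum>s<k. parity_bit s x)"

definition coeff_stopping_time :: "int \<Rightarrow> enat" where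
  "coeff_stopping_time x =
     (if \<exists>k\<ge>1. (2::nat) ^ k > 3 ^ odd_count k x
      then enat (LEAST k. k \<ge> 1 \<and> (2::nat) ^ k > 3 ^ odd_count k x)
      else \<infinity>)"

text \<open>The number \<open>n(x)\<close>. It is meaningful only for odd \<open>x\<close> with finite coefficient stopping
  time; in that case the count is at least 1, so the subtraction on \<open>nat\<close> does not truncate.\<close>

definition odd_index :: "int \<Rightarrow> nat" where
  "odd_index x = odd_count (the_enat (coeff_stopping_time x)) x - 1"

definition kappa :: "nat \<Rightarrow> int" where
  "kappa n = \<lfloor>real n * log 2 3\<rfloor>"

definition sigma_val :: "nat \<Rightarrow> nat" where
  "sigma_val n = nat \<lfloor>1 + (real n + 1) * log 2 3\<rfloor>"

text \<open>An integer vector with entries indexed by \<open>1, \<dots>, n+1\<close> is an extensional function on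
  \<open>{1..n+1}\<close>, so that two vectors are equal iff all their entries are.\<close>

definition admissible :: "nat \<Rightarrow> (nat \<Rightarrow> int) set" where
  "admissible n =
     {\<alpha> \<in> {1..n+1} \<rightarrow>\<^sub>E UNIV.
        \<alpha> 1 = 0 \<and> (\<forall>i\<in>{1..n}. \<alpha> i < \<alpha> (i + 1)) \<and> (\<forall>i\<in>{1..n}. \<alpha> (i + 1) \<le> kappa i)}"

definition full_vector :: "nat \<Rightarrow> (nat \<Rightarrow> int) \<Rightarrow> nat list" where
  "full_vector n \<alpha> = map (\<lambda>s. if int s \<in> \<alpha> ` {1..n+1} then 1 else 0) [0..<sigma_val n]"

definition residue_of :: "nat \<Rightarrow> (nat \<Rightarrow> int) \<Rightarrow> int" where
  "residue_of n \<alpha> =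
     (THE c. c \<in> {1..2 ^ sigma_val n - 1} \<and> parity_vector (sigma_val n) c = full_vector n \<alpha>)"

definition residues_set :: "nat \<Rightarrow> int set" where
  "residues_set n = {residue_of n \<alpha> | \<alpha>. \<alpha> \<in> admissible n}"

end

theory Submission
  imports Defs
begin

text \<open>
  Two facts carry the proof.

  The first is Terras's theorem: the first \<open>k\<close> parities of the orbit of \<open>x\<close> depend exactly on
  \<open>x\<close> modulo \<open>2\<^sup>k\<close>, and every 0-1 vector of length \<open>k\<close> occurs
  (\<open>parity_vector_eq_iff\<close>, \<open>ex_parity_vector\<close>). Membership of \<open>x mod 2\<^sup>\<sigma>\<close> in a set of
  residues defined by parity vectors is thereby a condition on the parity vector of \<open>x\<close> itself, and
  both bijections follow once an admissible \<open>\<alpha>\<close> can be recovered from its 0-1 vector. That is so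
  because \<open>\<alpha>\<close> is the increasing enumeration of the positions of the ones.

  The second is that \<open>2\<^sup>k > 3\<^sup>m\<close> says precisely \<open>k > \<kappa>(m)\<close>
  (\<open>three_power_less_two_power_iff\<close>). Let \<open>\<alpha>\<^sub>1 < \<alpha>\<^sub>2 < \<dots>\<close> be the times at which the orbit of
  an odd \<open>x\<close> is odd. Just before time \<open>\<alpha>\<^bsub>i+1\<^esub>\<close> exactly \<open>i\<close> odd terms have been seen, and while
  \<open>i\<close> is the current count, \<open>\<alpha>\<^bsub>i+1\<^esub>\<close> is the last time with that count. So the
  process does not stop at any time with count \<open>i\<close> iff \<open>\<alpha>\<^bsub>i+1\<^esub> \<le> \<kappa>(i)\<close>. After the
  \<open>(n+1)\<close>-st odd term the count stays at \<open>n+1\<close> until the stopping time, which must be the first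
  integer above \<open>\<kappa>(n+1)\<close>, namely \<open>\<sigma>\<^sub>n\<close>. The inequalities defining an admissible vector
  are therefore exactly the condition of stopping at \<open>\<sigma>\<^sub>n\<close> with \<open>n+1\<close> odd terms
  (\<open>stopping_if_admissible\<close>, \<open>admissible_if_stopping\<close>).
\<close>

section \<open>Parity vectors and residues modulo powers of two\<close>

lemma parity_vector_0 [simp]: "parity_vector 0 x = []"
  by (simp add: parity_vector_def)

lemma parity_vector_Suc:
  "parity_vector (Suc k) x = (if odd x then 1 else 0) # parity_vector k (T x)"
proof -
  have "parity_bit (Suc s) x = parity_bit s (T x)" for s
    by (simp add: parity_bit_def funpow_swap1)
  moreover have "parity_bit 0 x = (if odd x then 1 else 0)"
    by (simp add: parity_bit_def)
  ultimately show ?thesis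
    unfolding parity_vector_def upt_conv_Cons[OF zero_less_Suc] map_Suc_upt[symmetric]
    by (simp del: upt_Suc)
qed

text \<open>
  On integers of a fixed parity, \<open>2 T(x)\<close> is \<open>x\<close> or \<open>3x + 1\<close>. Since 3 is odd, congruence of the
  images modulo \<open>2\<^sup>k\<close> is the same as congruence of the arguments modulo \<open>2\<^bsup>k+1\<^esup>\<close>.
\<close>

lemma T_cong_iff:
  assumes "odd x \<longleftrightarrow> odd y"
  shows "2 ^ k dvd T x - T y \<longleftrightarrow> 2 ^ Suc k dvd x - y"
proof -
  have "2 ^ k dvd T x - T y \<longleftrightarrow> 2 ^ Suc k dvd 2 * (T x - T y)"
    unfolding power_Suc by (subst dvd_mult_cancel_left) simp
  also have "\<dots> \<longleftrightarrow> 2 ^ Suc k dvd x - y"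
  proof (cases "odd x")
    case True
    then have "2 * T x = 3 * x + 1" "2 * T y = 3 * y + 1"
      using assms True unfolding T_def by presburger+
    then have "2 * (T x - T y) = 3 * (x - y)" by simp
    moreover have "coprime (2 ^ Suc k) (3 :: int)"
      by simp
    ultimately show ?thesis
      by (simp only: coprime_dvd_mult_right_iff)
  next
    case False
    then have "2 * (T x - T y) = x - y"
      using assms by (auto simp: T_def elim!: evenE)
    then show ?thesis by simp
  qed
  finally show ?thesis .
qed

lemma parity_vector_eq_iff_dvd:
  "parity_vector k x = parity_vector k y \<longleftrightarrow> 2 ^ k dvd x - y"
proof (induction k arbitrary: x y)
  case 0
  show ?case by simp
next
  case (Suc k)
  show ?case
  proof (cases "odd x \<longleftrightarrow> odd y")
    case True
    then show ?thesis
      by (simp add: parity_vector_Suc Suc.IH T_cong_iff del: power_Suc)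
  next
    case False
    then have "\<not> 2 dvd x - y" by auto
    then have "\<not> 2 ^ Suc k dvd x - y"
      unfolding power_Suc using dvd_mult_left by blast
    with False show ?thesis
      by (simp add: parity_vector_Suc del: power_Suc)
  qed
qed

lemma parity_vector_eq_iff:
  "parity_vector k x = parity_vector k y \<longleftrightarrow> x mod 2 ^ k = y mod 2 ^ k"
  by (simp add: parity_vector_eq_iff_dvd mod_eq_dvd_iff)

lemma ex_parity_vector:
  assumes "length l = k" "set l \<subseteq> {0, 1}"
  shows "\<exists>x. parity_vector k x = l"
  using assms
proof (induction k arbitrary: l)
  case 0
  then show ?case by simp
next
  case (Suc k)
  then obtain b l' where l: "l = b # l'" "length l' = k" "set l' \<subseteq> {0, 1}" "b \<in> {0, 1}"
    by (cases l) auto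
  from Suc.IH[OF l(2,3)] obtain y where y: "parity_vector k y = l'" ..
  show ?case
  proof (cases "b = 0")
    case True
    then have "parity_vector (Suc k) (2 * y) = l"
      using y l by (simp add: parity_vector_Suc T_def)
    then show ?thesis ..
  next
    case False
    \<comment> \<open>An odd preimage under \<open>T\<close> requires a target that is 2 modulo 3; since
        \<open>4\<^sup>k\<close> is 1 modulo 3, the following shift of \<open>y\<close> by a multiple of \<open>2\<^sup>k\<close> achieves this.\<close>
    define z where "z = y + 4 ^ k * (2 - y)"
    have "(4::int) ^ k mod 3 = 1"
      using power_mod[of "4::int" 3 k] by simp
    then obtain t where "(4::int) ^ k = 3 * t + 1"
      by (metis mult_div_mod_eq)
    then have "z = 3 * (t * (2 - y)) + 2"
      by (simp add: z_def algebra_simps)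
    then have "T (2 * (t * (2 - y)) + 1) = z"
      by (simp add: T_def)
    moreover have "parity_vector k z = parity_vector k y"
    proof -
      have "(2::int) ^ k dvd 4 ^ k" by (intro dvd_power_same) simp
      then show ?thesis by (simp add: parity_vector_eq_iff_dvd z_def)
    qed
    ultimately have "parity_vector (Suc k) (2 * (t * (2 - y)) + 1) = l"
      using y l False by (simp add: parity_vector_Suc)
    then show ?thesis ..
  qed
qed

section \<open>The thresholds for stopping\<close>

lemma three_power_less_two_power_iff: "(3::nat) ^ m < 2 ^ k \<longleftrightarrow> kappa m < int k"
proof -
  have "(3::nat) ^ m < 2 ^ k \<longleftrightarrow> real (3 ^ m) < real (2 ^ k)"
    by (rule of_nat_less_iff[symmetric])
  also have "\<dots> \<longleftrightarrow> (3::real) ^ m < 2 ^ k"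
    by simp
  also have "\<dots> \<longleftrightarrow> log 2 (3 ^ m) < log 2 (2 ^ k)"
    by (subst log_less_cancel_iff) auto
  also have "\<dots> \<longleftrightarrow> real m * log 2 3 < real k"
    by (simp add: log_nat_power)
  also have "\<dots> \<longleftrightarrow> kappa m < int k"
    by (simp add: kappa_def floor_less_iff)
  finally show ?thesis .
qed

lemma kappa_mono: "m \<le> m' \<Longrightarrow> kappa m \<le> kappa m'"
  unfolding kappa_def by (intro floor_mono mult_right_mono) auto

lemma kappa_nonneg: "0 \<le> kappa m"
  by (simp add: kappa_def)

lemma sigma_val_eq: "int (sigma_val n) = kappa (Suc n) + 1"
proof -
  have "\<lfloor>1 + (real n + 1) * log 2 3\<rfloor> = kappa (Suc n) + 1"
    unfolding kappa_def by (simp add: add.commute)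
  then show ?thesis
    using kappa_nonneg[of "Suc n"] by (simp add: sigma_val_def)
qed

lemma sigma_val_pos: "0 < sigma_val n"
  using sigma_val_eq[of n] kappa_nonneg[of "Suc n"] by linarith

lemma coeff_stopping_time_eq_iff:
  assumes "N \<ge> 1"
  shows "coeff_stopping_time x = enat N \<longleftrightarrow>
    kappa (odd_count N x) < int N \<and> (\<forall>k. 1 \<le> k \<and> k < N \<longrightarrow> int k \<le> kappa (odd_count k x))"
    (is "_ \<longleftrightarrow> ?R")
proof -
  let ?P = "\<lambda>k. k \<ge> 1 \<and> kappa (odd_count k x) < int k"
  have cst: "coeff_stopping_time x = (if \<exists>k. ?P k then enat (LEAST k. ?P k) else \<infinity>)"
    by (simp add: coeff_stopping_time_def three_power_less_two_power_iff)
  show ?thesis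
  proof
    assume eq: "coeff_stopping_time x = enat N"
    then have ex: "\<exists>k. ?P k" and N: "N = (LEAST k. ?P k)"
      by (auto simp: cst split: if_splits)
    have "?P N"
      unfolding N using ex by (rule LeastI_ex)
    moreover have "\<not> ?P k" if "k < N" for k
      using that unfolding N by (rule not_less_Least)
    ultimately show ?R by force
  next
    assume R: ?R
    then have "?P N" using assms by simp
    moreover have "(LEAST k. ?P k) = N"
      using R assms by (intro Least_equality) (auto simp: not_less[symmetric])
    ultimately show "coeff_stopping_time x = enat N"
      by (auto simp: cst)
  qed
qed

section \<open>Increasing vectors and counting\<close>

lemma admissible_strict_mono:
  assumes "\<alpha> \<in> admissible n"
  shows "strict_mono_on {1..n+1} \<alpha>"
proof (rule strict_mono_onI)
  fix i j assume ij: "i \<in> {1..n+1}" "j \<in> {1..n+1}" "i < j"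
  have "\<alpha> i < \<alpha> (i + Suc d)" if "i + Suc d \<le> n + 1" for d
    using that
  proof (induction d)
    case 0
    then show ?case using assms ij by (auto simp: admissible_def)
  next
    case (Suc d)
    then have "\<alpha> (i + Suc d) < \<alpha> (i + Suc d + 1)"
      using assms ij unfolding admissible_def by force
    then show ?case using Suc by simp
  qed
  from this[of "j - i - 1"] show "\<alpha> i < \<alpha> j" using ij by simp
qed

lemma card_below_entry:
  fixes \<alpha> :: "nat \<Rightarrow> int"
  assumes "strict_mono_on {1..n} \<alpha>" "i \<in> {1..n}"
  shows "card {j \<in> {1..n}. \<alpha> j < \<alpha> i} = i - 1"
proof -
  have "{j \<in> {1..n}. \<alpha> j < \<alpha> i} = {1..<i}"
    using assms strict_mono_on_less[OF assms(1)] by auto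
  then show ?thesis by simp
qed

text \<open>
  An entry is the \<open>i\<close>-th one exactly when \<open>i - 1\<close> elements of the image lie below it, so
  the image alone determines the position of each of its elements.
\<close>

lemma strict_mono_on_image_unique:
  fixes \<alpha> \<beta> :: "nat \<Rightarrow> int"
  assumes \<alpha>: "strict_mono_on {1..n} \<alpha>" and \<beta>: "strict_mono_on {1..n} \<beta>"
    and im: "\<alpha> ` {1..n} = \<beta> ` {1..n}" and i: "i \<in> {1..n}"
  shows "\<alpha> i = \<beta> i"
proof -
  have card_image_below: "card {a \<in> \<gamma> ` {1..n}. a < \<gamma> j} = j - 1"
    if \<gamma>: "strict_mono_on {1..n} \<gamma>" and "j \<in> {1..n}" for \<gamma> :: "nat \<Rightarrow> int" and j
  proof -
    have "{a \<in> \<gamma> ` {1..n}. a < \<gamma> j} = \<gamma> ` {l \<in> {1..n}. \<gamma> l < \<gamma> j}" by auto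
    moreover have "inj_on \<gamma> {l \<in> {1..n}. \<gamma> l < \<gamma> j}"
      using strict_mono_on_imp_inj_on[OF \<gamma>] by (rule inj_on_subset) auto
    ultimately show ?thesis
      using card_below_entry that by (simp add: card_image)
  qed
  obtain j where j: "j \<in> {1..n}" "\<alpha> i = \<beta> j"
    using im i by (metis imageE imageI)
  have "i - 1 = j - 1"
    using card_image_below[OF \<alpha> i] card_image_below[OF \<beta> j(1)] im j(2) by simp
  moreover have "1 \<le> i" "1 \<le> j" using i j by simp_all
  ultimately have "i = j" by linarith
  then show ?thesis using j(2) by simp
qed

text \<open>
  Both directions of the stopping-time characterization read off the number of odd terms before
  time \<open>k\<close> from the vector of odd times: it is the number of its entries below \<open>k\<close>.
\<close>

lemma card_entries_below_eq_odd_count: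
  fixes \<alpha> :: "nat \<Rightarrow> int"
  assumes mono: "strict_mono_on {1..m} \<alpha>" and nonneg: "\<forall>i\<in>{1..m}. 0 \<le> \<alpha> i"
    and ones: "\<forall>s<N. int s \<in> \<alpha> ` {1..m} \<longleftrightarrow> odd ((T ^^ s) x)" and k: "k \<le> N"
  shows "odd_count k x = card {i \<in> {1..m}. \<alpha> i < int k}"
proof -
  have "odd_count k x = card {s \<in> {..<k}. odd ((T ^^ s) x)}"
    unfolding odd_count_def parity_bit_def by (simp add: sum.If_cases Int_def)
  also have "\<dots> = card {i \<in> {1..m}. \<alpha> i < int k}"
  proof (rule bij_betw_same_card[symmetric])
    show "bij_betw (\<lambda>i. nat (\<alpha> i)) {i \<in> {1..m}. \<alpha> i < int k} {s \<in> {..<k}. odd ((T ^^ s) x)}"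
    proof (rule bij_betw_imageI)
      show "inj_on (\<lambda>i. nat (\<alpha> i)) {i \<in> {1..m}. \<alpha> i < int k}"
      proof (rule inj_onI)
        fix i j assume "i \<in> {i \<in> {1..m}. \<alpha> i < int k}" "j \<in> {i \<in> {1..m}. \<alpha> i < int k}"
          and "nat (\<alpha> i) = nat (\<alpha> j)"
        then have "i \<in> {1..m}" "j \<in> {1..m}" "\<alpha> i = \<alpha> j"
          using nonneg by (auto dest: eq_nat_nat_iff[THEN iffD1, rotated 2])
        then show "i = j"
          using strict_mono_on_imp_inj_on[OF mono] by (simp add: inj_on_eq_iff)
      qed
      show "(\<lambda>i. nat (\<alpha> i)) ` {i \<in> {1..m}. \<alpha> i < int k} = {s \<in> {..<k}. odd ((T ^^ s) x)}"
      proof (intro equalityI subsetI)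
        fix s assume "s \<in> (\<lambda>i. nat (\<alpha> i)) ` {i \<in> {1..m}. \<alpha> i < int k}"
        then obtain i where i: "i \<in> {1..m}" "\<alpha> i < int k" "int s = \<alpha> i"
          using nonneg by force
        then have "int s \<in> \<alpha> ` {1..m}" "s < k" by force+
        then show "s \<in> {s \<in> {..<k}. odd ((T ^^ s) x)}"
          using ones k by simp
      next
        fix s assume s: "s \<in> {s \<in> {..<k}. odd ((T ^^ s) x)}"
        then obtain i where "i \<in> {1..m}" "int s = \<alpha> i"
          using ones k less_le_trans
          by (metis (no_types, lifting) imageE lessThan_iff mem_Collect_eq)
        then show "s \<in> (\<lambda>i. nat (\<alpha> i)) ` {i \<in> {1..m}. \<alpha> i < int k}"
          using s by (intro image_eqI[of _ _ i]) (simp_all flip: \<open>int s = \<alpha> i\<close>)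
      qed
    qed
  qed
  finally show ?thesis .
qed

section \<open>Admissible vectors and their parity vectors\<close>

lemma admissible_bounds:
  assumes "\<alpha> \<in> admissible n" "i \<in> {1..n+1}"
  shows "0 \<le> \<alpha> i" "\<alpha> i < int (sigma_val n)"
proof -
  note mono = strict_mono_on_leD[OF admissible_strict_mono[OF assms(1)]]
  have "\<alpha> 1 = 0" using assms by (simp add: admissible_def)
  then show "0 \<le> \<alpha> i" using mono[of 1 i] assms(2) by simp
  show "\<alpha> i < int (sigma_val n)"
  proof (cases "i = 1")
    case True
    then show ?thesis using \<open>\<alpha> 1 = 0\<close> sigma_val_pos by simp
  next
    case False
    then have "i - 1 \<in> {1..n}" using assms(2) by auto
    then have "\<alpha> (i - 1 + 1) \<le> kappa (i - 1)"
      using assms(1) unfolding admissible_def by blast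
    also have "\<dots> \<le> kappa (Suc n)" using assms(2) by (intro kappa_mono) auto
    finally show ?thesis using False assms(2) by (simp add: sigma_val_eq)
  qed
qed

lemma parity_vector_eq_full_vector_iff:
  "parity_vector (sigma_val n) x = full_vector n \<alpha> \<longleftrightarrow>
    (\<forall>s<sigma_val n. int s \<in> \<alpha> ` {1..n+1} \<longleftrightarrow> odd ((T ^^ s) x))"
  by (auto simp: parity_vector_def full_vector_def parity_bit_def)

lemma full_vector_inj: "inj_on (full_vector n) (admissible n)"
proof (rule inj_onI)
  fix \<alpha> \<beta> assume \<alpha>: "\<alpha> \<in> admissible n" and \<beta>: "\<beta> \<in> admissible n"
    and eq: "full_vector n \<alpha> = full_vector n \<beta>"
  have mem: "a \<in> \<gamma> ` {1..n+1} \<longleftrightarrow>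
      0 \<le> a \<and> a < int (sigma_val n) \<and> full_vector n \<gamma> ! nat a = 1"
    if "\<gamma> \<in> admissible n" for \<gamma> a
  proof (cases "0 \<le> a \<and> a < int (sigma_val n)")
    case True
    then have "full_vector n \<gamma> ! nat a = (if a \<in> \<gamma> ` {1..n+1} then 1 else 0)"
      by (simp add: full_vector_def nat_less_iff del: One_nat_def)
    then show ?thesis using True by simp
  next
    case False
    then have "a \<notin> \<gamma> ` {1..n+1}" using admissible_bounds[OF that] by (metis imageE)
    with False show ?thesis by blast
  qed
  have "\<alpha> ` {1..n+1} = \<beta> ` {1..n+1}"
    by (intro set_eqI) (simp only: mem[OF \<alpha>] mem[OF \<beta>] eq)
  then have "\<alpha> i = \<beta> i" if "i \<in> {1..n+1}" for i
    using strict_mono_on_image_unique[OF \<alpha>[THEN admissible_strict_mono]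
        \<beta>[THEN admissible_strict_mono]] that by blast
  moreover have "\<alpha> \<in> extensional {1..n+1}" "\<beta> \<in> extensional {1..n+1}"
    using \<alpha> \<beta> by (auto simp: admissible_def PiE_def)
  ultimately show "\<alpha> = \<beta>" by (rule extensionalityI[rotated 2])
qed

lemma odd_if_parity_vector_eq_full_vector:
  assumes "\<alpha> \<in> admissible n" "parity_vector (sigma_val n) x = full_vector n \<alpha>"
  shows "odd x"
proof -
  have "\<alpha> 1 = 0" using assms(1) by (simp add: admissible_def)
  then have "int 0 \<in> \<alpha> ` {1..n+1}" by force
  then show ?thesis
    using assms(2) sigma_val_pos[of n] unfolding parity_vector_eq_full_vector_iff by force
qed

lemma residue_of_properties:
  assumes "\<alpha> \<in> admissible n"
  shows "residue_of n \<alpha> \<in> {1..2 ^ sigma_val n - 1}"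
    and "parity_vector (sigma_val n) (residue_of n \<alpha>) = full_vector n \<alpha>"
proof -
  let ?M = "2 ^ sigma_val n :: int"
  let ?P = "\<lambda>c. c \<in> {1..?M - 1} \<and> parity_vector (sigma_val n) c = full_vector n \<alpha>"
  have "length (full_vector n \<alpha>) = sigma_val n" "set (full_vector n \<alpha>) \<subseteq> {0, 1}"
    by (auto simp: full_vector_def)
  from ex_parity_vector[OF this]
  obtain y where y: "parity_vector (sigma_val n) y = full_vector n \<alpha>" ..
  have eq: "parity_vector (sigma_val n) (y mod ?M) = full_vector n \<alpha>"
    using y parity_vector_eq_iff[of "sigma_val n" "y mod ?M" y] by simp
  \<comment> \<open>The first parity is 1, so the residue is odd and in particular not 0.\<close>
  then have "odd (y mod ?M)"
    using odd_if_parity_vector_eq_full_vector assms by blast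
  then have "y mod ?M \<noteq> 0" by (metis even_zero)
  moreover have "0 \<le> y mod ?M" "y mod ?M < ?M" by simp_all
  ultimately have "1 \<le> y mod ?M" "y mod ?M \<le> ?M - 1" by linarith+
  with eq have P: "?P (y mod ?M)" by (simp only: atLeastAtMost_iff)
  have "c = y mod ?M" if "?P c" for c
  proof -
    have "c mod ?M = y mod ?M"
      using that y by (intro parity_vector_eq_iff[THEN iffD1]) simp
    moreover have "c mod ?M = c"
      using that by (intro mod_pos_pos_trivial) simp_all
    ultimately show ?thesis by simp
  qed
  then have res: "?P (residue_of n \<alpha>)"
    unfolding residue_of_def by (rule theI[where P = ?P, OF P])
  show "residue_of n \<alpha> \<in> {1..?M - 1}"
    using res by (rule conjunct1)
  show "parity_vector (sigma_val n) (residue_of n \<alpha>) = full_vector n \<alpha>"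
    using res by (rule conjunct2)
qed

lemma residue_of_mod:
  assumes "\<alpha> \<in> admissible n"
  shows "residue_of n \<alpha> mod 2 ^ sigma_val n = residue_of n \<alpha>"
proof (rule mod_pos_pos_trivial)
  show "0 \<le> residue_of n \<alpha>" "residue_of n \<alpha> < 2 ^ sigma_val n"
    using residue_of_properties(1)[OF assms] by simp_all
qed

lemma residue_of_eq_iff:
  assumes "\<alpha> \<in> admissible n"
  shows "x mod 2 ^ sigma_val n = residue_of n \<alpha> \<longleftrightarrow>
    parity_vector (sigma_val n) x = full_vector n \<alpha>"
  using parity_vector_eq_iff[of "sigma_val n" x "residue_of n \<alpha>"]
  unfolding residue_of_mod[OF assms] residue_of_properties(2)[OF assms] by (rule sym)

section \<open>Admissibility and the coefficient stopping time\<close>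

text \<open>
  At a time \<open>k < \<sigma>\<^sub>n\<close> with count \<open>m\<close> the process has not stopped: if \<open>m = n + 1\<close> this is
  the definition of \<open>\<sigma>\<^sub>n\<close>, and otherwise the next odd time \<open>\<alpha>\<^bsub>m+1\<^esub>\<close> is at least \<open>k\<close> while it
  is at most \<open>\<kappa>(m)\<close>.
\<close>

lemma stopping_if_admissible:
  assumes \<alpha>: "\<alpha> \<in> admissible n"
    and pv: "parity_vector (sigma_val n) x = full_vector n \<alpha>"
  shows "coeff_stopping_time x = enat (sigma_val n)" "odd_count (sigma_val n) x = n + 1"
proof -
  note bounds = admissible_bounds[OF \<alpha>]
  note mono = admissible_strict_mono[OF \<alpha>]
  have count: "odd_count k x = card {i \<in> {1..n+1}. \<alpha> i < int k}" if "k \<le> sigma_val n" for k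
    using card_entries_below_eq_odd_count[OF mono _ _ that] bounds pv
    unfolding parity_vector_eq_full_vector_iff by blast
  have "{i \<in> {1..n+1}. \<alpha> i < int (sigma_val n)} = {1..n+1}"
    using bounds by blast
  then show total: "odd_count (sigma_val n) x = n + 1"
    using count[of "sigma_val n"] by simp
  show "coeff_stopping_time x = enat (sigma_val n)"
  proof (subst coeff_stopping_time_eq_iff, goal_cases)
    case 1
    show ?case using sigma_val_pos[of n] by simp
  next
    case 2
    have "int k \<le> kappa (odd_count k x)" if k: "1 \<le> k" "k < sigma_val n" for k
    proof -
      define m where "m = odd_count k x"
      have m: "m = card {i \<in> {1..n+1}. \<alpha> i < int k}"
        using count k by (simp add: m_def)
      have "m \<le> card {1..n+1}" unfolding m by (intro card_mono) auto
      moreover have "1 \<in> {i \<in> {1..n+1}. \<alpha> i < int k}"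
        using \<alpha> k by (simp add: admissible_def)
      then have "m \<noteq> 0" unfolding m by (subst card_0_eq) auto
      ultimately consider "m = n + 1" | "m \<in> {1..n}" by fastforce
      then have "int k \<le> kappa m"
      proof cases
        case 1
        then show ?thesis using k sigma_val_eq[of n] by simp
      next
        case 2
        have "int k \<le> \<alpha> (m + 1)"
        proof (rule ccontr)
          assume "\<not> int k \<le> \<alpha> (m + 1)"
          then have "{1..m+1} \<subseteq> {i \<in> {1..n+1}. \<alpha> i < int k}"
            using 2 strict_mono_on_leD[OF mono, of _ "m + 1"] by force
          then have "card {1..m+1} \<le> m" unfolding m by (intro card_mono) auto
          then show False by simp
        qed
        also have "\<dots> \<le> kappa m" using \<alpha> 2 by (simp add: admissible_def)
        finally show ?thesis .
      qed
      then show ?thesis by (simp add: m_def)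
    qed
    then show ?case using total sigma_val_eq[of n] by simp
  qed
qed

lemma ex_strict_mono_enumeration:
  fixes S :: "nat set"
  assumes "finite S" "card S = m"
  shows "\<exists>\<alpha> \<in> {1..m} \<rightarrow>\<^sub>E (UNIV :: int set). strict_mono_on {1..m} \<alpha> \<and> \<alpha> ` {1..m} = int ` S"
proof -
  define l where "l = sorted_list_of_set S"
  have l: "length l = m" "set l = S" "sorted_wrt (<) l"
    using assms by (simp_all add: l_def)
  define \<alpha> where "\<alpha> = (\<lambda>i\<in>{1..m}. int (l ! (i - 1)))"
  have "strict_mono_on {1..m} \<alpha>"
    using l by (intro strict_mono_onI) (auto simp: \<alpha>_def intro!: sorted_wrt_nth_less[OF l(3)])
  moreover have "\<alpha> ` {1..m} = int ` S"
  proof -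
    have "(\<lambda>i. i - 1) ` {1..m} = {..<m}"
      by (auto simp: image_iff intro!: bexI[of _ "Suc _"])
    then have "int ` S = (\<lambda>j. int (l ! j)) ` (\<lambda>i. i - 1) ` {1..m}"
      using l by (auto simp: in_set_conv_nth image_iff)
    then show ?thesis by (simp add: \<alpha>_def image_image)
  qed
  moreover have "\<alpha> \<in> {1..m} \<rightarrow>\<^sub>E UNIV" by (auto simp: \<alpha>_def)
  ultimately show ?thesis by blast
qed

text \<open>
  Exactly \<open>i\<close> odd terms precede time \<open>\<alpha>\<^bsub>i+1\<^esub>\<close>, and this time is positive and earlier than the
  stopping time; not having stopped there is the inequality \<open>\<alpha>\<^bsub>i+1\<^esub> \<le> \<kappa>(i)\<close>.
\<close>

lemma admissible_if_stopping:
  assumes "odd x" and stop: "coeff_stopping_time x = enat (sigma_val n)"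
    and total: "odd_count (sigma_val n) x = n + 1"
  shows "\<exists>\<alpha>\<in>admissible n. parity_vector (sigma_val n) x = full_vector n \<alpha>"
proof -
  define S where "S = {s \<in> {..<sigma_val n}. odd ((T ^^ s) x)}"
  have card_S: "card S = n + 1"
    using total unfolding S_def odd_count_def parity_bit_def by (simp add: sum.If_cases Int_def)
  have "finite S" by (simp add: S_def)
  from ex_strict_mono_enumeration[OF this card_S] obtain \<alpha> :: "nat \<Rightarrow> int"
    where ext: "\<alpha> \<in> {1..n+1} \<rightarrow>\<^sub>E UNIV" and mono: "strict_mono_on {1..n+1} \<alpha>"
      and im: "\<alpha> ` {1..n+1} = int ` S"
    by blast
  have bounds: "0 \<le> \<alpha> i" "\<alpha> i < int (sigma_val n)" if "i \<in> {1..n+1}" for i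
  proof -
    have "\<alpha> i \<in> int ` S" using that im by blast
    then show "0 \<le> \<alpha> i" "\<alpha> i < int (sigma_val n)" by (auto simp: S_def)
  qed
  have ones: "\<forall>s<sigma_val n. int s \<in> \<alpha> ` {1..n+1} \<longleftrightarrow> odd ((T ^^ s) x)"
    unfolding im by (auto simp: S_def)
  have first: "\<alpha> 1 = 0"
  proof -
    have "0 \<in> S" using assms(1) sigma_val_pos by (simp add: S_def)
    then have "int 0 \<in> \<alpha> ` {1..n+1}" unfolding im by blast
    then obtain i where "i \<in> {1..n+1}" "\<alpha> i = 0" by auto
    moreover have "\<alpha> 1 \<le> \<alpha> i"
      using strict_mono_on_leD[OF mono, of 1 i] calculation by auto
    ultimately show ?thesis using bounds(1)[of 1] by simp
  qed
  have "\<alpha> (i + 1) \<le> kappa i" if i: "i \<in> {1..n}" for i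
  proof -
    have mem: "i + 1 \<in> {1..n+1}" using i by simp
    define k where "k = nat (\<alpha> (i + 1))"
    have k: "int k = \<alpha> (i + 1)" using bounds(1)[OF mem] by (simp add: k_def)
    have "\<alpha> 1 < \<alpha> (i + 1)"
      using strict_mono_onD[OF mono, of 1 "i + 1"] i by simp
    then have "1 \<le> k" "k < sigma_val n"
      using k first bounds(2)[OF mem] by simp_all
    moreover have "odd_count k x = i"
      using card_entries_below_eq_odd_count[OF mono _ ones, of k] bounds(1)
        card_below_entry[OF mono mem] k \<open>k < sigma_val n\<close> by auto
    ultimately show ?thesis
      using stop coeff_stopping_time_eq_iff[of "sigma_val n" x] k by fastforce
  qed
  moreover have "\<alpha> i < \<alpha> (i + 1)" if "i \<in> {1..n}" for i
    using strict_mono_onD[OF mono, of i "i + 1"] that by simp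
  ultimately have "\<alpha> \<in> admissible n"
    using ext first by (simp add: admissible_def)
  then show ?thesis
    using ones parity_vector_eq_full_vector_iff by blast
qed

lemma stopping_iff_residue:
  assumes "n \<ge> 1" "odd x"
  shows "coeff_stopping_time x = enat (sigma_val n) \<and> odd_index x = n \<longleftrightarrow>
    x mod 2 ^ sigma_val n \<in> residues_set n"
proof -
  have "coeff_stopping_time x = enat (sigma_val n) \<and> odd_index x = n \<longleftrightarrow>
      coeff_stopping_time x = enat (sigma_val n) \<and> odd_count (sigma_val n) x = n + 1"
    unfolding odd_index_def
  proof (rule conj_cong[OF refl])
    assume "coeff_stopping_time x = enat (sigma_val n)"
    then show "odd_count (the_enat (coeff_stopping_time x)) x - 1 = n \<longleftrightarrow>
        odd_count (sigma_val n) x = n + 1"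
      using assms(1) by auto
  qed
  also have "\<dots> \<longleftrightarrow> (\<exists>\<alpha>\<in>admissible n. parity_vector (sigma_val n) x = full_vector n \<alpha>)"
    using admissible_if_stopping[OF assms(2)] stopping_if_admissible by blast
  also have "\<dots> \<longleftrightarrow> x mod 2 ^ sigma_val n \<in> residues_set n"
    unfolding residues_set_def using residue_of_eq_iff by blast
  finally show ?thesis .
qed

theorem theorem7:
  fixes n :: nat
  assumes "n \<ge> 1"
  shows "(\<forall>x::int. x > 1 \<and> odd x \<longrightarrow>
            (coeff_stopping_time x = enat (sigma_val n) \<and> odd_index x = n
              \<longleftrightarrow> x mod 2 ^ sigma_val n \<in> residues_set n))
       \<and> bij_betw (residue_of n) (admissible n) (residues_set n)
       \<and> bij_betw (parity_vector (sigma_val n)) (residues_set n) {full_vector n \<alpha> | \<alpha>. \<alpha> \<in> admissible n}"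
proof (intro conjI allI impI)
  fix x :: int assume "x > 1 \<and> odd x"
  then show "coeff_stopping_time x = enat (sigma_val n) \<and> odd_index x = n
      \<longleftrightarrow> x mod 2 ^ sigma_val n \<in> residues_set n"
    using stopping_iff_residue assms by blast
next
  have res: "residues_set n = residue_of n ` admissible n"
    by (auto simp: residues_set_def)
  have "inj_on (parity_vector (sigma_val n) \<circ> residue_of n) (admissible n)"
    using full_vector_inj residue_of_properties(2) by (simp cong: inj_on_cong)
  then show "bij_betw (residue_of n) (admissible n) (residues_set n)"
    unfolding res by (intro bij_betw_imageI inj_on_imageI2[of _ "residue_of n"]) auto
  show "bij_betw (parity_vector (sigma_val n)) (residues_set n)
      {full_vector n \<alpha> | \<alpha>. \<alpha> \<in> admissible n}"
  proof (rule bij_betw_imageI)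
    show "inj_on (parity_vector (sigma_val n)) (residues_set n)"
      unfolding res using residue_of_mod
      by (auto simp: inj_on_def parity_vector_eq_iff)
    show "parity_vector (sigma_val n) ` residues_set n =
        {full_vector n \<alpha> | \<alpha>. \<alpha> \<in> admissible n}"
      unfolding res image_image using residue_of_properties(2) by (auto simp: image_iff)
  qed
qed

end
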